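(* The competitive ratio of any deterministic online algorithm for Online Sum-Radii Clustering in tree metrics is $\Omega(\log n)$, where $n$ is the number of demands.
   Context: Online Sum-Radii Clustering: given a metric space $(M,d)$ and opening cost $f>0$, demand points $u_1,\dots,u_n\in M$ arrive one by one; upon arrival of $u_j$, if $u_j$ is not contained in an already opened cluster, the algorithm must irrevocably open a new cluster $C(p,r)=\{v\in M:d(p,v)\le r\}$ containing $u_j$ (fixing center $p$ and radius $r$) at cost $f+r$. An algorithm is $c$-competitive if for every demand sequence its cost is at most $c$ times the optimal offline cost, i.e. the minimum of $\sum_i(f+r_i)$ over collections of clusters $C(p_i,r_i)$ covering all demands. A tree metric is the shortest-path metric on the nodes of a tree with non-negative edge lengths. *)

theory Defs
  imports "HOL-Analysis.Analysis"
begin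

section \<open>Tree metrics\<close>

definition simple_path :: "'a set \<Rightarrow> 'a set set \<Rightarrow> 'a list \<Rightarrow> bool" where
  "simple_path V E xs \<longleftrightarrow>
     xs \<noteq> [] \<and> set xs \<subseteq> V \<and> distinct xs \<and> successively (\<lambda>x y. {x, y} \<in> E) xs"

definition paths_between :: "'a set \<Rightarrow> 'a set set \<Rightarrow> 'a \<Rightarrow> 'a \<Rightarrow> 'a list set" where
  "paths_between V E x y = {xs. simple_path V E xs \<and> hd xs = x \<and> last xs = y}"

definition is_tree :: "'a set \<Rightarrow> 'a set set \<Rightarrow> bool" where
  "is_tree V E \<longleftrightarrow>
     finite V \<and> V \<noteq> {} \<and>
     E \<subseteq> {{x, y} |x y. x \<in> V \<and> y \<in> V \<and> x \<noteq> y} \<and>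
     (\<forall>x\<in>V. \<forall>y\<in>V. paths_between V E x y \<noteq> {}) \<and>
     \<not> (\<exists>xs. simple_path V E xs \<and> 3 \<le> length xs \<and> {last xs, hd xs} \<in> E)"

definition path_length :: "('a set \<Rightarrow> real) \<Rightarrow> 'a list \<Rightarrow> real" where
  "path_length w xs = (\<Sum>i<length xs - 1. w {xs ! i, xs ! Suc i})"

text \<open>
  Zero edge lengths are allowed, so such a \<open>d\<close> is in general only a pseudometric on \<open>V\<close>;
  its values outside \<open>V\<close> are irrelevant.
\<close>

definition tree_metric :: "'a set \<Rightarrow> ('a \<Rightarrow> 'a \<Rightarrow> real) \<Rightarrow> bool" where
  "tree_metric V d \<longleftrightarrow>
     (\<exists>E w. is_tree V E \<and> (\<forall>e\<in>E. 0 \<le> w e) \<and>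
        (\<forall>x\<in>V. \<forall>y\<in>V. d x y = (INF xs\<in>paths_between V E x y. path_length w xs)))"

section \<open>Sum-radii clustering\<close>

text \<open>A pair \<open>(p, r)\<close> stands for the cluster with center \<open>p\<close> and radius \<open>r\<close>.\<close>

definition cluster :: "'a set \<Rightarrow> ('a \<Rightarrow> 'a \<Rightarrow> real) \<Rightarrow> 'a \<times> real \<Rightarrow> 'a set" where
  "cluster M d = (\<lambda>(p, r). {v \<in> M. d p v \<le> r})"

definition covered :: "'a set \<Rightarrow> ('a \<Rightarrow> 'a \<Rightarrow> real) \<Rightarrow> ('a \<times> real) list \<Rightarrow> 'a set" where
  "covered M d cs = (\<Union>c\<in>set cs. cluster M d c)"

definition clustering_cost :: "real \<Rightarrow> ('a \<times> real) list \<Rightarrow> real" where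
  "clustering_cost f cs = (\<Sum>(p, r)\<leftarrow>cs. f + r)"

definition feasible :: "'a set \<Rightarrow> ('a \<Rightarrow> 'a \<Rightarrow> real) \<Rightarrow> 'a list \<Rightarrow> ('a \<times> real) list \<Rightarrow> bool" where
  "feasible M d us cs \<longleftrightarrow> (\<forall>(p, r)\<in>set cs. p \<in> M \<and> 0 \<le> r) \<and> set us \<subseteq> covered M d cs"

definition opt_cost :: "'a set \<Rightarrow> ('a \<Rightarrow> 'a \<Rightarrow> real) \<Rightarrow> real \<Rightarrow> 'a list \<Rightarrow> real" where
  "opt_cost M d f us = (INF cs\<in>{cs. feasible M d us cs}. clustering_cost f cs)"

section \<open>Deterministic online algorithms\<close>

text \<open>
  A deterministic online algorithm maps the demands \<open>u\<^sub>1, \<dots>, u\<^sub>j\<close> seen so far to the cluster it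
  opens on arrival of \<open>u\<^sub>j\<close>.  The answer is used only if \<open>u\<^sub>j\<close> lies in none of the clusters opened
  before.  Clusters already opened are determined by the history, so they need not be an argument.
\<close>

type_synonym 'a algorithm = "'a list \<Rightarrow> 'a \<times> real"

fun opened :: "'a set \<Rightarrow> ('a \<Rightarrow> 'a \<Rightarrow> real) \<Rightarrow> 'a algorithm \<Rightarrow> 'a list \<Rightarrow> ('a \<times> real) list" where
  "opened M d A us =
     (if us = [] then []
      else let cs = opened M d A (butlast us)
           in if last us \<in> covered M d cs then cs else cs @ [A us])"

declare opened.simps [simp del]

lemma opened_Nil [simp]: "opened M d A [] = []"
  by (simp add: opened.simps)

lemma opened_snoc:
  "opened M d A (us @ [u]) =
     (let cs = opened M d A us
      in if u \<in> covered M d cs then cs else cs @ [A (us @ [u])])"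
  by (subst opened.simps) simp

definition online_algorithm :: "'a set \<Rightarrow> ('a \<Rightarrow> 'a \<Rightarrow> real) \<Rightarrow> 'a algorithm \<Rightarrow> bool" where
  "online_algorithm M d A \<longleftrightarrow>
     (\<forall>us u. set us \<subseteq> M \<longrightarrow> u \<in> M \<longrightarrow> u \<notin> covered M d (opened M d A us) \<longrightarrow>
        fst (A (us @ [u])) \<in> M \<and> u \<in> cluster M d (A (us @ [u])))"

definition competitive ::
  "'a set \<Rightarrow> ('a \<Rightarrow> 'a \<Rightarrow> real) \<Rightarrow> real \<Rightarrow> 'a algorithm \<Rightarrow> nat \<Rightarrow> real \<Rightarrow> bool" where
  "competitive M d f A n c \<longleftrightarrow>
     (\<forall>us. length us = n \<longrightarrow> set us \<subseteq> M \<longrightarrow>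
        clustering_cost f (opened M d A us) \<le> c * opt_cost M d f us)"

text \<open>The infimum is \<open>\<infinity>\<close> if the algorithm is not \<open>c\<close>-competitive for any real \<open>c\<close>.\<close>

definition competitive_ratio ::
  "'a set \<Rightarrow> ('a \<Rightarrow> 'a \<Rightarrow> real) \<Rightarrow> real \<Rightarrow> 'a algorithm \<Rightarrow> nat \<Rightarrow> ereal" where
  "competitive_ratio M d f A n = (INF c\<in>{c. competitive M d f A n c}. ereal c)"

end

theory Submission
  imports Defs
begin

text \<open>
  Let the nodes be \<open>0, \<dots>, 3 ^ K - 1\<close>, and join every node to the one obtained by clearing its lowest
  nonzero ternary digit; if that digit has position \<open>i\<close>, the edge has length \<open>2 ^ i * f\<close>.  A block of
  level \<open>j\<close>, that is a set of nodes with the same quotient by \<open>3 ^ j\<close>, is then covered by one cluster of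
  cost \<open>2 ^ j * f\<close>, while a cluster meeting two such blocks costs at least a constant multiple of
  \<open>2 ^ j * f\<close>.

  The adversary runs through the nodes in increasing order and demands those outside all blocks that
  the algorithm's earlier clusters could meet, each such cluster being rounded up to a block around the
  demand that caused it.  Covering all demands by blocks of one fixed level \<open>j \<le> K\<close> is a feasible
  solution.  A block that is not covered in one piece has three children that are all paid for, which
  costs \<open>3 / 2\<close> times as much; so the charges to a cluster decay geometrically both above and below
  its own level, and the \<open>K + 1\<close> offline solutions together cost \<open>O(1)\<close> times the cost of the algorithm.
  The best of them is therefore cheaper by a factor of order \<open>K\<close>.
\<close>

section \<open>Attaching leaves to a tree\<close>

text \<open>The only neighbour of \<open>v\<close> is \<open>u\<close>. A simple path through the
  interior of \<open>v\<close> would meet \<open>u\<close> on both sides, so \<open>v\<close> can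
  only be an end.\<close>

lemma simple_path_insert_leaf:
  assumes E: "E \<subseteq> {{x, y} |x y. x \<in> V \<and> y \<in> V \<and> x \<noteq> y}" and u: "u \<in> V" and v: "v \<notin> V"
    and xs: "simple_path (insert v V) (insert {u, v} E) xs"
  obtains "simple_path V E xs" | "xs = [v]"
    | ys where "xs = v # ys" "simple_path V E ys" "hd ys = u"
    | ys where "xs = ys @ [v]" "simple_path V E ys" "last ys = u"
proof -
  have sub: "successively (\<lambda>x y. {x, y} \<in> E) ys"
    if "successively (\<lambda>x y. {x, y} \<in> insert {u, v} E) ys" "v \<notin> set ys" for ys
    using that by (induction ys rule: induct_list012) (auto simp: doubleton_eq_iff)
  have nb: "x = u" if "{v, x} \<in> insert {u, v} E" for x
    using that E v by (auto simp: doubleton_eq_iff)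
  show thesis
  proof (cases "v \<in> set xs")
    case False
    with xs sub[of xs] that(1) show ?thesis by (auto simp: simple_path_def)
  next
    case True
    then obtain as bs where ab: "xs = as @ v # bs" by (meson split_list)
    with xs have d: "v \<notin> set as" "v \<notin> set bs" "distinct as" "distinct bs"
        "set as \<subseteq> V" "set bs \<subseteq> V" "set as \<inter> set bs = {}"
      by (auto simp: simple_path_def)
    have s: "successively (\<lambda>x y. {x, y} \<in> insert {u, v} E) as"
       "successively (\<lambda>x y. {x, y} \<in> insert {u, v} E) bs"
       "as \<noteq> [] \<Longrightarrow> {v, last as} \<in> insert {u, v} E" "bs \<noteq> [] \<Longrightarrow> {v, hd bs} \<in> insert {u, v} E"
      using xs unfolding simple_path_def ab
      by (auto simp: successively_append_iff successively_Cons insert_commute)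
    have as: "as \<noteq> [] \<Longrightarrow> simple_path V E as \<and> last as = u"
      using s(1,3) d sub[of as] nb by (auto simp: simple_path_def)
    have bs: "bs \<noteq> [] \<Longrightarrow> simple_path V E bs \<and> hd bs = u"
      using s(2,4) d sub[of bs] nb by (auto simp: simple_path_def)
    have "as = [] \<or> bs = []"
      using as bs d(7) by (metis disjoint_iff hd_in_set last_in_set)
    then show ?thesis using that ab as bs by (cases "as = []"; cases "bs = []") auto
  qed
qed

lemma path_length_Cons: "ys \<noteq> [] \<Longrightarrow> path_length w (x # ys) = w {x, hd ys} + path_length w ys"
  by (cases ys) (auto simp: path_length_def sum.lessThan_Suc_shift simp del: sum.lessThan_Suc)

lemma path_length_snoc: "ys \<noteq> [] \<Longrightarrow> path_length w (ys @ [x]) = path_length w ys + w {last ys, x}"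
  by (induction ys) (auto simp: path_length_Cons path_length_def[of _ "[_]"] hd_append)

lemma path_length_fun_upd:
  assumes "v \<notin> set xs"
  shows "path_length (w({u, v} := W)) xs = path_length w xs"
  unfolding path_length_def
proof (intro sum.cong refl)
  fix i assume "i \<in> {..<length xs - 1}"
  then have "xs ! i \<in> set xs" "xs ! Suc i \<in> set xs" by auto
  with assms show "(w({u, v} := W)) {xs ! i, xs ! Suc i} = w {xs ! i, xs ! Suc i}"
    by (auto simp: doubleton_eq_iff)
qed

text \<open>On a cycle through \<open>v\<close> both neighbours of \<open>v\<close> would be
  \<open>u\<close>. Listed with \<open>v\<close> as one end, the rest would start and end in
  \<open>u\<close>, hence be a single node, and the list would be too short.\<close>

lemma is_tree_insert_leaf:
  assumes T: "is_tree V E" and u: "u \<in> V" and v: "v \<notin> V"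
  shows "is_tree (insert v V) (insert {u, v} E)"
proof -
  have E: "E \<subseteq> {{x, y} |x y. x \<in> V \<and> y \<in> V \<and> x \<noteq> y}" using T by (simp add: is_tree_def)
  have acyc: "\<not> (simple_path V E xs \<and> 3 \<le> length xs \<and> {last xs, hd xs} \<in> E)" for xs
    using T by (auto simp: is_tree_def)
  have mono: "simple_path (insert v V) (insert {u, v} E) xs" if "simple_path V E xs" for xs
    using that by (auto simp: simple_path_def elim!: successively_mono)
  have single: "length ys = 1" if "distinct ys" "ys \<noteq> []" "hd ys = last ys" for ys :: "'a list"
    using that by (cases ys) (auto split: if_splits)
  have ne: "paths_between (insert v V) (insert {u, v} E) x y \<noteq> {}"
    if x: "x \<in> insert v V" and y: "y \<in> insert v V" for x y
  proof -
    have path: "\<exists>xs. simple_path V E xs \<and> hd xs = a \<and> last xs = b" if "a \<in> V" "b \<in> V" for a b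
      using T that by (fastforce simp: is_tree_def paths_between_def)
    consider "x \<in> V" "y \<in> V" | "x = v" "y \<in> V" | "x \<in> V" "y = v" | "x = v" "y = v"
      using x y by auto
    then show ?thesis
    proof cases
      case 1
      then show ?thesis using path mono by (fastforce simp: paths_between_def)
    next
      case 2
      then obtain xs where "simple_path V E xs" "hd xs = u" "last xs = y" using path u by blast
      with mono[of xs] v 2 have "v # xs \<in> paths_between (insert v V) (insert {u, v} E) x y"
        by (auto simp: paths_between_def simple_path_def successively_Cons insert_commute)
      then show ?thesis by blast
    next
      case 3
      then obtain xs where "simple_path V E xs" "hd xs = x" "last xs = u" using path u by blast
      with mono[of xs] v 3 have "xs @ [v] \<in> paths_between (insert v V) (insert {u, v} E) x y"
        by (auto simp: paths_between_def simple_path_def successively_append_iff)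
      then show ?thesis by blast
    next
      case 4
      then have "[v] \<in> paths_between (insert v V) (insert {u, v} E) x y"
        by (auto simp: paths_between_def simple_path_def)
      then show ?thesis by blast
    qed
  qed
  have nocycle: False if xs: "simple_path (insert v V) (insert {u, v} E) xs" "3 \<le> length xs"
    "{last xs, hd xs} \<in> insert {u, v} E" for xs
    using E u v xs(1)
  proof (cases rule: simple_path_insert_leaf)
    case 1
    then have "last xs \<in> V" "hd xs \<in> V" unfolding simple_path_def by auto
    then have "v \<notin> {last xs, hd xs}" using v by auto
    then show False using 1 acyc[of xs] xs by auto
  next
    case 2
    then show False using xs by simp
  next
    case (3 ys)
    then have "last ys = u" using xs(3) E v by (auto simp: simple_path_def doubleton_eq_iff)
    then show False using 3 xs(2) single[of ys] by (auto simp: simple_path_def)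
  next
    case (4 ys)
    then have "hd ys = u" using xs(3) E v by (auto simp: simple_path_def doubleton_eq_iff)
    then show False using 4 xs(2) single[of ys] by (auto simp: simple_path_def)
  qed
  have edge: "e \<in> {{x, y} |x y. x \<in> insert v V \<and> y \<in> insert v V \<and> x \<noteq> y}" if "e \<in> insert {u, v} E" for e
  proof (cases "e = {u, v}")
    case True
    then show ?thesis using u v by blast
  next
    case False
    with that have "e \<in> E" by simp
    then obtain x y where "e = {x, y}" "x \<in> V" "y \<in> V" "x \<noteq> y" using subsetD[OF E] by force
    then show ?thesis by blast
  qed
  have "finite (insert v V)" "insert v V \<noteq> {}" using T by (auto simp: is_tree_def)
  moreover have "insert {u, v} E \<subseteq> {{x, y} |x y. x \<in> insert v V \<and> y \<in> insert v V \<and> x \<noteq> y}"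
    by (rule subsetI) (rule edge)
  moreover have "\<not> (\<exists>xs. simple_path (insert v V) (insert {u, v} E) xs \<and> 3 \<le> length xs \<and>
      {last xs, hd xs} \<in> insert {u, v} E)"
    by (metis nocycle)
  ultimately show ?thesis
    unfolding is_tree_def using ne by (intro conjI ballI)
qed

section \<open>Metrics given by a parent function\<close>

text \<open>A weighted tree rooted at \<open>0\<close> whose parents are smaller than their
  children. The larger of two nodes is never an ancestor of the smaller, so the path between them
  leaves it through its parent; \<open>step\<close> is thus a full recursion for the
  distance.\<close>

locale parent_metric =
  fixes p :: "nat \<Rightarrow> nat" and W :: "nat \<Rightarrow> real" and d :: "nat \<Rightarrow> nat \<Rightarrow> real"
  assumes p: "0 < x \<Longrightarrow> p x < x" and W: "0 < x \<Longrightarrow> 0 < W x"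
    and sym: "d x y = d y x" and refl [simp]: "d x x = 0"
    and step: "y < x \<Longrightarrow> d x y = d (p x) y + W x"
begin

text \<open>The parent of \<open>Suc m\<close> lies in \<open>{..m}\<close>, so the tree grows by
  one leaf at a time.\<close>

lemma tree_metric_atMost: "tree_metric {..m} d"
proof -
  \<comment> \<open>Fixing the length of every simple path by its ends makes the infimum in
    \<open>tree_metric\<close> range over a single value.\<close>
  have "\<exists>E w. is_tree {..m} E \<and> (\<forall>e\<in>E. 0 \<le> w e) \<and>
      (\<forall>xs. simple_path {..m} E xs \<longrightarrow> path_length w xs = d (hd xs) (last xs))"
  proof (induction m)
    case 0
    have single: "xs = [0]" if "simple_path {..0::nat} {} xs" for xs
      using that by (cases xs) (auto simp: simple_path_def successively_Cons)
    have "[0] \<in> paths_between {..0::nat} {} 0 0"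
      by (simp add: paths_between_def simple_path_def)
    then have "is_tree {..0::nat} {}" by (auto simp: is_tree_def)
    moreover have "path_length w xs = d (hd xs) (last xs)" if "simple_path {..0} {} xs" for w xs
      by (simp add: single[OF that] path_length_def)
    ultimately show ?case by blast
  next
    case (Suc m)
    then obtain E w where T: "is_tree {..m} E" and w: "\<forall>e\<in>E. 0 \<le> w e"
      and len: "\<And>xs. simple_path {..m} E xs \<Longrightarrow> path_length w xs = d (hd xs) (last xs)"
      by blast
    let ?v = "Suc m" and ?u = "p (Suc m)"
    let ?w = "w({?u, ?v} := W ?v)"
    have u: "?u \<in> {..m}" and v: "?v \<notin> {..m}" using p[of ?v] by auto
    have E: "E \<subseteq> {{x, y} |x y. x \<in> {..m} \<and> y \<in> {..m} \<and> x \<noteq> y}" using T by (simp add: is_tree_def)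
    have ins: "{..Suc m} = insert ?v {..m}" by auto
    have upd: "path_length ?w xs = d (hd xs) (last xs)" if "simple_path {..m} E xs" for xs
      using that v len[of xs] by (subst path_length_fun_upd) (auto simp: simple_path_def)
    have "path_length ?w xs = d (hd xs) (last xs)"
      if "simple_path {..Suc m} (insert {?u, ?v} E) xs" for xs
      using E u v that[unfolded ins]
    proof (cases rule: simple_path_insert_leaf)
      case 1
      then show ?thesis by (rule upd)
    next
      case 2
      then show ?thesis by (simp add: path_length_def)
    next
      case (3 ys)
      then have "ys \<noteq> []" "last ys < ?v" by (auto simp: simple_path_def less_Suc_eq_le subset_iff)
      with 3 show ?thesis
        using upd[of ys] step[of "last ys" ?v] by (simp add: path_length_Cons insert_commute)
    next
      case (4 ys)
      then have "ys \<noteq> []" "hd ys < ?v" by (auto simp: simple_path_def less_Suc_eq_le subset_iff)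
      with 4 show ?thesis
        using upd[of ys] step[of "hd ys" ?v] sym[of "hd ys" ?u] sym[of "hd ys" ?v]
        by (simp add: path_length_snoc)
    qed
    moreover have "\<forall>e\<in>insert {?u, ?v} E. 0 \<le> ?w e"
      using w W[of ?v] by auto
    ultimately show ?case
      using is_tree_insert_leaf[OF T u v] unfolding ins by blast
  qed
  then obtain E w where T: "is_tree {..m} E" and w: "\<forall>e\<in>E. 0 \<le> w e"
    and len: "\<And>xs. simple_path {..m} E xs \<Longrightarrow> path_length w xs = d (hd xs) (last xs)"
    by blast
  have "d x y = (INF xs\<in>paths_between {..m} E x y. path_length w xs)" if "x \<in> {..m}" "y \<in> {..m}" for x y
  proof -
    have "path_length w ` paths_between {..m} E x y = {d x y}"
      using T that len unfolding is_tree_def by (fastforce simp: paths_between_def)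
    then show ?thesis by simp
  qed
  then show ?thesis using T w unfolding tree_metric_def by blast
qed

lemma nonneg: "0 \<le> d x y"
proof (induction "x + y" arbitrary: x y rule: less_induct)
  case less
  consider "x = y" | "y < x" | "x < y" by linarith
  then show ?case
  proof cases
    case 2
    then show ?thesis using less[of "p x" y] p[of x] W[of x] step[of y x] by auto
  next
    case 3
    then show ?thesis using less[of "p y" x] p[of y] W[of y] step[of x y] sym[of x y] by auto
  qed simp
qed

lemma eq_0: "d x y = 0 \<longleftrightarrow> x = y"
proof -
  have "0 < d x y" if "y < x" for x y
    using that step[OF that] W[of x] nonneg[of "p x" y] by simp
  from this[of x y] this[of y x] sym[of x y] show ?thesis by (cases x y rule: linorder_cases) auto
qed

text \<open>Of three distinct points the largest is replaced by its parent. For \<open>x\<close> or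
  \<open>z\<close> both sides drop by the same weight; for \<open>y\<close> only the right side
  drops.\<close>

lemma triangle: "d x z \<le> d x y + d y z"
proof (induction "x + y + z" arbitrary: x y z rule: less_induct)
  case less
  consider "x = y \<or> y = z \<or> x = z" | "y < x" "z < x" | "x < y" "z < y" | "x < z" "y < z"
    by linarith
  then show ?case
  proof cases
    case 1
    then show ?thesis using nonneg[of x y] nonneg[of y x] nonneg[of y z] by auto
  next
    case 2
    then show ?thesis using less[of "p x" y z] p[of x] step[of y x] step[of z x] by auto
  next
    case 3
    then show ?thesis
      using less[of x "p y" z] p[of y] step[of x y] step[of z y] sym[of x] W[of y] by auto
  next
    case 4
    then show ?thesis
      using less[of x y "p z"] p[of z] step[of x z] step[of y z] sym[of x z] sym[of y z]
        sym[of x "p z"] sym[of y "p z"] by auto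
  qed
qed

lemma Metric_space: "Metric_space V d"
  by unfold_locales (auto simp: nonneg sym eq_0 triangle)

end

section \<open>The ternary tree\<close>

text \<open>For \<open>x > 0\<close>, \<open>multiplicity 3 x\<close> is the position of the lowest
  nonzero ternary digit; rounding down to a multiple of the next power of 3 clears just that
  digit.\<close>

definition parent :: "nat \<Rightarrow> nat" where
  "parent x = x div 3 ^ Suc (multiplicity 3 x) * 3 ^ Suc (multiplicity 3 x)"

lemma parent_less: "0 < x \<Longrightarrow> parent x < x"
proof -
  assume "0 < x"
  then have "\<not> 3 ^ Suc (multiplicity 3 x) dvd x"
    by (subst power_dvd_iff_le_multiplicity) auto
  then have "parent x \<noteq> x" unfolding parent_def by (metis dvd_triv_right)
  moreover have "parent x \<le> x" unfolding parent_def by (rule div_times_less_eq_dividend)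
  ultimately show ?thesis by simp
qed

lemma parent_div:
  assumes "multiplicity 3 x < i"
  shows "parent x div 3 ^ i = x div 3 ^ i"
proof -
  from assms obtain k where i: "i = Suc (multiplicity 3 x) + k" by (metis less_iff_Suc_add add_Suc)
  show ?thesis unfolding i parent_def power_add
    by (simp only: div_mult2_eq) simp
qed

lemma dvd_parent: "3 ^ Suc (multiplicity 3 x) dvd parent x"
  by (simp add: parent_def)

text \<open>The recursion required by \<open>step\<close>, in units of the opening cost;
  \<open>f\<close> enters later as a factor.\<close>

function ternary_dist :: "nat \<Rightarrow> nat \<Rightarrow> real" where
  "ternary_dist x y =
     (if x = y then 0
      else if y < x then ternary_dist (parent x) y + 2 ^ multiplicity 3 x
      else ternary_dist x (parent y) + 2 ^ multiplicity 3 y)"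
  by auto
termination
  by (relation "Wellfounded.measure (\<lambda>(x, y). x + y)") (auto intro: parent_less)

declare ternary_dist.simps [simp del]

lemma ternary_dist_refl [simp]: "ternary_dist x x = 0"
  by (simp add: ternary_dist.simps)

lemma ternary_dist_sym: "ternary_dist x y = ternary_dist y x"
proof (induction x y rule: ternary_dist.induct)
  case (1 x y)
  then show ?case by (cases x y rule: linorder_cases) (auto simp: ternary_dist.simps[of x y] ternary_dist.simps[of y x])
qed

lemma ternary_dist_step: "y < x \<Longrightarrow> ternary_dist x y = ternary_dist (parent x) y + 2 ^ multiplicity 3 x"
  by (simp add: ternary_dist.simps)

text \<open>Passing to the parent leaves the level-\<open>i\<close> block only if the cleared digit
  has position at least \<open>i\<close>, and that edge alone has length at least
  \<open>2 ^ i\<close>.\<close>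

lemma ternary_dist_ge:
  assumes "x div 3 ^ i \<noteq> y div 3 ^ i"
  shows "2 ^ i \<le> ternary_dist x y"
proof -
  have nn: "0 \<le> ternary_dist x y" for x y
  proof (induction x y rule: ternary_dist.induct)
    case (1 x y)
    then show ?case by (auto simp: ternary_dist.simps[of x y])
  qed
  have "2 ^ i \<le> ternary_dist x y" if "y < x" "x div 3 ^ i \<noteq> y div 3 ^ i"
      "parent x div 3 ^ i \<noteq> y div 3 ^ i \<Longrightarrow> 2 ^ i \<le> ternary_dist (parent x) y" for x y
  proof (cases "parent x div 3 ^ i = y div 3 ^ i")
    case True
    then have "\<not> multiplicity 3 x < i" using parent_div that(2) by metis
    then have "(2::real) ^ i \<le> 2 ^ multiplicity 3 x" by simp
    then show ?thesis using ternary_dist_step[OF that(1)] nn[of "parent x" y] by linarith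
  next
    case False
    then show ?thesis using ternary_dist_step[OF that(1)] that(3)
      by (smt (verit) zero_less_power)
  qed
  note step = this
  show ?thesis using assms
  proof (induction x y rule: ternary_dist.induct)
    case (1 x y)
    consider "y < x" | "x < y" using 1(3) by (cases x y rule: linorder_cases) auto
    then show ?case
    proof cases
      case 1
      then show ?thesis using step[of y x] "1.IH"(1) "1.prems" by simp
    next
      case 2
      then show ?thesis using step[of x y] "1.IH"(2) "1.prems"
        by (metis ternary_dist_sym not_less_iff_gr_or_eq)
    qed
  qed
qed

text \<open>The walk to the smallest node of the block clears digits at positions \<open>i\<close>
  to \<open>j - 1\<close>, a geometric sum. The index \<open>i\<close>, below which all digits are
  zero, carries the downward induction.\<close>

lemma ternary_dist_block_root_le:
  assumes "i \<le> j" "3 ^ i dvd x"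
  shows "ternary_dist x (x div 3 ^ j * 3 ^ j) \<le> 2 ^ j - 2 ^ i"
  using assms
proof (induction arbitrary: x rule: inc_induct)
  case base
  then show ?case by simp
next
  case (step i)
  show ?case
  proof (cases "3 ^ Suc i dvd x")
    case True
    have "(2::real) ^ i \<le> 2 ^ Suc i" by simp
    with step.IH[OF True] show ?thesis by linarith
  next
    case False
    then have v: "multiplicity 3 x = i" using step.prems by (intro multiplicity_eqI) auto
    have "\<not> 3 ^ j dvd x" using False step.hyps by (meson Suc_leI dvd_trans le_imp_power_dvd)
    then have "x div 3 ^ j * 3 ^ j \<noteq> x" by (metis dvd_triv_right)
    then have "x div 3 ^ j * 3 ^ j < x" using div_times_less_eq_dividend[of x "3 ^ j"] by linarith
    from ternary_dist_step[OF this] v have "ternary_dist x (x div 3 ^ j * 3 ^ j) = ternary_dist (parent x) (parent x div 3 ^ j * 3 ^ j) + 2 ^ i"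
      using parent_div[of x j] step.hyps by simp
    also have "\<dots> \<le> 2 ^ j - 2 ^ Suc i + 2 ^ i"
      using step.IH[of "parent x"] dvd_parent[of x] v by simp
    finally show ?thesis by simp
  qed
qed

section \<open>The charging argument\<close>

text \<open>
  Here \<open>D\<close> is the set of demands, in order of arrival, and \<open>l u\<close> is the level of the block bought for \<open>u\<close>.
\<close>
lemma sum_card_blocks_le:
  fixes D :: "nat set" and l :: "nat \<Rightarrow> nat"
  assumes fin: "finite D"
    and sep: "\<And>u v. u \<in> D \<Longrightarrow> v \<in> D \<Longrightarrow> u < v \<Longrightarrow> v div 3 ^ l u \<noteq> u div 3 ^ l u"
    and cov: "\<And>x. x < 3 ^ K \<Longrightarrow> \<exists>u\<in>D. u \<le> x \<and> x div 3 ^ l u = u div 3 ^ l u"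
    and D: "D \<subseteq> {..<3 ^ K}"
  shows "(\<Sum>j\<le>K. 2 ^ j * real (card ((\<lambda>x. x div 3 ^ j) ` D))) \<le> 4 * (\<Sum>u\<in>D. 2 ^ l u)"
proof -
  \<comment> \<open>\<open>B i t\<close> holds the demands in block \<open>t\<close> of level
    \<open>i\<close>; \<open>S i t\<close> is the joint cost, in units of \<open>f\<close>, of the
    offline solutions of levels up to \<open>i\<close> for these demands; \<open>c u\<close> is the
    price of the block bought for \<open>u\<close>.\<close>
  define B where "B i t = {x \<in> D. x div 3 ^ i = t}" for i t
  define S where "S i t = (\<Sum>j\<le>i. 2 ^ j * real (card ((\<lambda>x. x div 3 ^ j) ` B i t)))" for i t
  define c :: "nat \<Rightarrow> real" where "c u = 2 ^ l u" for u
  have finB [simp]: "finite (B i t)" for i t using fin by (simp add: B_def)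
  have up: "x div 3 ^ j = y div 3 ^ j" if "x div 3 ^ i = y div 3 ^ i" "i \<le> j" for x y i j :: nat
  proof -
    have "z div 3 ^ j = z div 3 ^ i div 3 ^ (j - i)" for z :: nat
      using that(2) by (simp flip: div_mult2_eq power_add)
    then show ?thesis using that(1) by simp
  qed
  have child: "x div 3 ^ Suc i = t \<longleftrightarrow> x div 3 ^ i \<in> {3 * t, 3 * t + 1, 3 * t + 2}" for x i t :: nat
  proof -
    have "x div 3 ^ Suc i = x div 3 ^ i div 3" by (simp only: power_Suc2 div_mult2_eq)
    then show ?thesis by auto
  qed
  have BSuc: "B (Suc i) t = B i (3 * t) \<union> B i (3 * t + 1) \<union> B i (3 * t + 2)" for i t
    unfolding B_def by (auto simp: child simp del: power_Suc)
  have disj: "B i s \<inter> B i t = {}" if "s \<noteq> t" for i s t using that by (auto simp: B_def)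
  have csum: "sum c (B (Suc i) t) = (\<Sum>k<3. sum c (B i (3 * t + k)))" for i t
    unfolding BSuc by (simp add: eval_nat_numeral sum.union_disjoint disj Int_Un_distrib2)
  \<comment> \<open>The solution of level \<open>Suc i\<close> uses at most one block here; at lower
    levels the cost is split among the three children.\<close>
  have Sstep: "S (Suc i) t \<le> 2 ^ Suc i + (\<Sum>k<3. S i (3 * t + k))" for i t
  proof -
    have "(\<lambda>x. x div 3 ^ Suc i) ` B (Suc i) t \<subseteq> {t}" by (auto simp: B_def)
    then have "card ((\<lambda>x. x div 3 ^ Suc i) ` B (Suc i) t) \<le> 1"
      by (metis card_mono finite.emptyI finite.insertI is_singletonI is_singleton_altdef)
    moreover have "2 ^ j * real (card ((\<lambda>x. x div 3 ^ j) ` B (Suc i) t)) \<le>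
        (\<Sum>k<3. 2 ^ j * real (card ((\<lambda>x. x div 3 ^ j) ` B i (3 * t + k))))" for j
    proof -
      have "card ((\<lambda>x. x div 3 ^ j) ` B (Suc i) t) \<le>
         (\<Sum>k<3. card ((\<lambda>x. x div 3 ^ j) ` B i (3 * t + k)))"
        unfolding BSuc image_Un
        by (simp add: eval_nat_numeral) (meson card_Un_le le_trans add_le_mono1)
      then have "real (card ((\<lambda>x. x div 3 ^ j) ` B (Suc i) t)) \<le>
         (\<Sum>k<3. real (card ((\<lambda>x. x div 3 ^ j) ` B i (3 * t + k))))"
        by (metis of_nat_mono of_nat_sum)
      then show ?thesis by (simp flip: sum_distrib_left)
    qed
    from sum_mono[of "{..i}", OF this] have "(\<Sum>j\<le>i. 2 ^ j * real (card ((\<lambda>x. x div 3 ^ j) ` B (Suc i) t)))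
      \<le> (\<Sum>k<3. S i (3 * t + k))" unfolding S_def by (subst (asm) sum.swap)
    ultimately show ?thesis unfolding S_def[of "Suc i"] 
      by (simp del: power_Suc add: add.commute add_mono)
  qed
  \<comment> \<open>A purchase of level at least \<open>i\<close> swallows the whole block, so no
    later demand falls into it.\<close>
  have uniq: "u = v" if "u \<in> B i t" "v \<in> B i t" "i \<le> l u" "i \<le> l v" for u v i t
    using that sep[of u v] sep[of v u] up[of u i v]
    by (cases u v rule: linorder_cases) (auto simp: B_def)
  \<comment> \<open>The smallest node \<open>s * 3 ^ i\<close> of the child lies in the block bought
    for some \<open>u\<close>. If \<open>l u \<le> i\<close>, then \<open>u\<close> is in the child.
    Otherwise \<open>u\<close> precedes the level-\<open>Suc i\<close> block and its purchase
    contains that block, so \<open>v\<close> would not have been demanded.\<close>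
  have ne: "B i s \<noteq> {}"
    if i: "i < K" "t < 3 ^ (K - Suc i)" and v: "v \<in> B (Suc i) t"
      and small: "\<And>u. u \<in> B (Suc i) t \<Longrightarrow> l u \<le> i" and s: "s div 3 = t" for i t s v
  proof -
    have "s < 3 ^ (K - i)" using i s by (auto simp: Suc_diff_Suc[symmetric])
    then have "s * 3 ^ i < 3 ^ (K - i) * 3 ^ i" by simp
    also have "\<dots> = (3::nat) ^ K" using i by (simp flip: power_add)
    finally obtain u where u: "u \<in> D" "u \<le> s * 3 ^ i" "s * 3 ^ i div 3 ^ l u = u div 3 ^ l u"
      using cov by blast
    have sT: "s * 3 ^ i div 3 ^ i = s" "s * 3 ^ i div 3 ^ Suc i = t" using s by auto
    show ?thesis
    proof (cases "l u \<le> i")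
      case True
      then show ?thesis using up[OF u(3) True] u(1) sT by (auto simp: B_def)
    next
      case False
      then have "u \<notin> B (Suc i) t" using small by auto
      then have nT: "u div 3 ^ Suc i \<noteq> t" using u by (auto simp: B_def)
      have "v div 3 ^ Suc i = s * 3 ^ i div 3 ^ Suc i" using v sT by (auto simp: B_def)
      with False u(3) have vu: "v div 3 ^ l u = u div 3 ^ l u" using up[of v "Suc i" "s * 3 ^ i" "l u"] by simp
      have "u div 3 ^ Suc i \<le> t" using div_le_mono[OF u(2)] sT(2) by metis
      with nT have "u div 3 ^ Suc i < v div 3 ^ Suc i" using v by (auto simp: B_def)
      then have "u < v" using div_le_mono not_le by metis
      then show ?thesis using sep[of u v] vu u v by (auto simp: B_def)
    qed
  qed
  \<comment> \<open>A block paid for from below leaves a slack of \<open>2 * 2 ^ i\<close>; three children then provide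
     \<open>6 * 2 ^ i = 3 * 2 ^ Suc i\<close>, enough for the parent's own term and its slack.  A purchase reaching
     above the block must not be counted yet, since it is to be charged by the larger blocks.\<close>
  have main: "B i t \<noteq> {} \<Longrightarrow> (\<forall>u\<in>B i t. i \<le> l u \<longrightarrow> S i t \<le> 4 * (sum c (B i t) - c u) + 2 * 2 ^ i) \<and>
      ((\<forall>u\<in>B i t. l u \<le> i) \<longrightarrow> S i t \<le> 4 * sum c (B i t) - 2 * 2 ^ i)"
    if "i \<le> K" "t < 3 ^ (K - i)" for i t
    using that
  proof (induction i arbitrary: t)
    case 0
    then have "B 0 t = {t}" by (auto simp: B_def)
    then show ?case by (auto simp: S_def c_def)
  next
    case (Suc i)
    have k: "3 * t + k < 3 ^ (K - i)" if "k < 3" for k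
      using that Suc.prems by (auto simp: Suc_diff_Suc[symmetric])
    have "i \<le> K" using Suc.prems by simp
    note IH = Suc.IH[OF _ this k, rotated]
    have sub: "v \<in> B (Suc i) t" if "v \<in> B i (3 * t + k)" "k < 3" for v k
      using that unfolding BSuc by (auto simp: eval_nat_numeral less_Suc_eq)
    have zero: "S i s \<le> 4 * sum c (B i s)" if "B i s = {}" for s using that by (simp add: S_def)
    \<comment> \<open>One child contains \<open>u\<close>; by \<open>uniq\<close> the other two have
      no purchase above level \<open>i\<close>, hence no positive slack. The slack
      \<open>2 * 2 ^ i\<close> of the first child and the new term \<open>2 ^ Suc i\<close> add up
      to \<open>2 * 2 ^ Suc i\<close>.\<close>
    have big: "S (Suc i) t \<le> 4 * (sum c (B (Suc i) t) - c u) + 2 * 2 ^ Suc i"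
      if u: "u \<in> B (Suc i) t" "Suc i \<le> l u" for u
    proof -
      obtain k0 where k0: "k0 < 3" "u \<in> B i (3 * t + k0)"
      proof -
        have "u \<in> B i (3 * t + 0) \<or> u \<in> B i (3 * t + 1) \<or> u \<in> B i (3 * t + 2)" using u unfolding BSuc by auto
        then show thesis using that[of 0] that[of 1] that[of 2] by auto
      qed
      have "S i (3 * t + k) \<le> 4 * sum c (B i (3 * t + k)) + (if k = k0 then 2 * 2 ^ i - 4 * c u else 0)"
        if k: "k < 3" for k
      proof (cases "k = k0")
        case True
        then have "u \<in> B i (3 * t + k)" "i \<le> l u" using k0 u by auto
        then have "S i (3 * t + k) \<le> 4 * (sum c (B i (3 * t + k)) - c u) + 2 * 2 ^ i"
          using IH[OF k] by blast
        then show ?thesis using True by simp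
      next
        case False
        have "l v \<le> i" if v: "v \<in> B i (3 * t + k)" for v
        proof (rule ccontr)
          assume "\<not> l v \<le> i"
          moreover have "v \<in> B (Suc i) t" using sub v k by blast
          ultimately have "u = v" using u by (intro uniq[of u "Suc i" t v]) auto
          then show False using v k0 False by (auto simp: B_def)
        qed
        then have "S i (3 * t + k) \<le> 4 * sum c (B i (3 * t + k)) - 2 * 2 ^ i" if "B i (3 * t + k) \<noteq> {}"
          using IH[OF k] that by blast
        moreover have "4 * sum c (B i (3 * t + k)) - 2 * 2 ^ i \<le> 4 * sum c (B i (3 * t + k))" by simp
        ultimately have "S i (3 * t + k) \<le> 4 * sum c (B i (3 * t + k))"
          using zero[of "3 * t + k"] order_trans by blast
        then show ?thesis using False by simp
      qed
      then have "(\<Sum>k<3. S i (3 * t + k)) \<le>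
          (\<Sum>k<3. 4 * sum c (B i (3 * t + k)) + (if k = k0 then 2 * 2 ^ i - 4 * c u else 0))"
        by (intro sum_mono) auto
      also have "\<dots> = 4 * sum c (B (Suc i) t) + (2 * 2 ^ i - 4 * c u)"
        using k0(1) unfolding csum by (simp only: sum.distrib sum_distrib_left) simp
      finally have "(\<Sum>k<3. S i (3 * t + k)) \<le> 4 * sum c (B (Suc i) t) + (2 * 2 ^ i - 4 * c u)" .
      with Sstep[of i t] show ?thesis by simp
    qed
    moreover have "S (Suc i) t \<le> 4 * sum c (B (Suc i) t) - 2 * 2 ^ Suc i"
      if small: "\<forall>u\<in>B (Suc i) t. l u \<le> Suc i"
    proof (cases "\<exists>u\<in>B (Suc i) t. l u = Suc i")
      case True
      then obtain u where "u \<in> B (Suc i) t" "l u = Suc i" by blast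
      \<comment> \<open>Omitting \<open>u\<close> saves \<open>4 * 2 ^ Suc i\<close>, which turns
        the slack of \<open>2 * 2 ^ Suc i\<close> into its negative.\<close>
      then show ?thesis using big[of u] by (simp add: c_def)
    next
      case False
      then have s: "l u \<le> i" if "u \<in> B (Suc i) t" for u using small that le_Suc_eq by blast
      obtain v where v: "v \<in> B (Suc i) t" using Suc.prems by blast
      have "S i (3 * t + k) \<le> 4 * sum c (B i (3 * t + k)) - 2 * 2 ^ i" if k: "k < 3" for k
      proof -
        have "B i (3 * t + k) \<noteq> {}" using ne[of i t v "3 * t + k"] Suc.prems v s k by auto
        moreover have "\<forall>u\<in>B i (3 * t + k). l u \<le> i"
          using k s sub by blast
        ultimately show ?thesis using IH[OF k] by blast
      qed
      then have "(\<Sum>k<3. S i (3 * t + k)) \<le> (\<Sum>k<3. 4 * sum c (B i (3 * t + k)) - 2 * 2 ^ i)"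
        by (intro sum_mono) auto
      also have "\<dots> = 4 * sum c (B (Suc i) t) - 6 * 2 ^ i"
        unfolding csum by (simp only: sum_subtractf sum_distrib_left) simp
      finally have "(\<Sum>k<3. S i (3 * t + k)) \<le> 4 * sum c (B (Suc i) t) - 6 * 2 ^ i" .
      with Sstep[of i t] show ?thesis by simp
    qed
    ultimately show ?case by blast
  qed
  have BK: "B K 0 = D" using D by (auto simp: B_def)
  obtain u0 where "u0 \<in> D" using cov[of 0] by auto
  then have neD: "B K 0 \<noteq> {}" using BK by auto
  have "S K 0 \<le> 4 * sum c D"
  proof (cases "\<exists>u\<in>D. K \<le> l u")
    case True
    then obtain u where u: "u \<in> D" "K \<le> l u" by blast
    then have "(2::real) ^ K \<le> c u" by (simp add: c_def)
    \<comment> \<open>The omitted \<open>4 * c u\<close> is at least \<open>4 * 2 ^ K\<close> and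
      outweighs the slack.\<close>
    moreover have "S K 0 \<le> 4 * (sum c D - c u) + 2 * 2 ^ K" using main[of K 0] neD u BK by simp
    ultimately show ?thesis using zero_le_power[of "2::real" K] by argo
  next
    case False
    then have "\<forall>u\<in>D. l u \<le> K" by (meson nat_le_linear)
    then have "S K 0 \<le> 4 * sum c D - 2 * 2 ^ K" using main[of K 0] neD BK by simp
    then show ?thesis using zero_le_power[of "2::real" K] by argo
  qed
  then show ?thesis by (simp add: S_def BK c_def[abs_def])
qed

section \<open>The adversary\<close>

lemma clustering_cost_nonneg:
  assumes "0 \<le> f" "\<forall>(p, r)\<in>set cs. 0 \<le> r"
  shows "0 \<le> clustering_cost f cs"
  using assms by (induction cs) (auto simp: clustering_cost_def)

lemma opt_cost_le:
  assumes "0 < f" "feasible M d us cs"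
  shows "opt_cost M d f us \<le> clustering_cost f cs"
  unfolding opt_cost_def
proof (rule cINF_lower)
  show "bdd_below (clustering_cost f ` {cs. feasible M d us cs})"
    using assms(1) by (fastforce simp: feasible_def intro!: bdd_belowI2[of _ 0] clustering_cost_nonneg)
qed (use assms(2) in simp)

text \<open>Provides the positive optimum to divide by. A feasible solution is supplied because the
  real infimum over the empty set has no meaningful value.\<close>

lemma opt_cost_ge:
  assumes f: "0 < f" and us: "us \<noteq> []" and feas: "feasible M d us cs"
  shows "f \<le> opt_cost M d f us"
  unfolding opt_cost_def
proof (rule cINF_greatest)
  show "{cs. feasible M d us cs} \<noteq> {}" using feas by auto
  fix cs assume "cs \<in> {cs. feasible M d us cs}"
  then have cs: "feasible M d us cs" by simp
  then obtain p r cs' where "cs = (p, r) # cs'"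
    using us by (cases cs) (auto simp: feasible_def covered_def)
  moreover from this have "0 \<le> r" "0 \<le> clustering_cost f cs'"
    using cs f by (auto simp: feasible_def intro!: clustering_cost_nonneg)
  ultimately show "f \<le> clustering_cost f cs" by (simp add: clustering_cost_def)
qed

text \<open>Allows padding a demand sequence to a prescribed length at no cost to the
  algorithm.\<close>

lemma opened_append_covered:
  assumes "set vs \<subseteq> covered M d (opened M d A us)"
  shows "opened M d A (us @ vs) = opened M d A us"
  using assms
proof (induction vs rule: rev_induct)
  case (snoc v vs)
  then show ?case using opened_snoc[of M d A "us @ vs" v] by (simp add: Let_def)
qed simp

lemma parent_metric_scaled_ternary_dist:
  assumes "0 < f"
  shows "parent_metric parent (\<lambda>x. f * 2 ^ multiplicity 3 x) (\<lambda>x y. f * ternary_dist x y)"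
  using assms by unfold_locales (auto simp: parent_less ternary_dist_step algebra_simps intro: ternary_dist_sym)

text \<open>One cluster per block, centered at its smallest node; with the opening cost, the radius
  \<open>f * (2 ^ j - 1)\<close> gives exactly \<open>f * 2 ^ j\<close>.\<close>

lemma feasible_block_roots:
  assumes f: "0 < f" and us: "set us \<subseteq> {..<3 ^ K}"
  shows "feasible {..<3 ^ K} (\<lambda>x y. f * ternary_dist x y) us
    (map (\<lambda>t. (t * 3 ^ j, f * (2 ^ j - 1))) (sorted_list_of_set ((\<lambda>x. x div 3 ^ j) ` set us)))"
proof -
  have root: "x div 3 ^ j * 3 ^ j < 3 ^ K" if "x \<in> set us" for x
    using us that by (auto intro: le_less_trans[OF div_times_less_eq_dividend])
  have "f * ternary_dist (x div 3 ^ j * 3 ^ j) x \<le> f * (2 ^ j - 1)" for x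
    using f ternary_dist_block_root_le[of 0 j x] by (simp add: ternary_dist_sym[of _ x])
  then show ?thesis
    unfolding feasible_def covered_def cluster_def using f us root by auto
qed

lemma opt_cost_le_card_blocks:
  assumes f: "0 < f" and us: "set us \<subseteq> {..<3 ^ K}"
  shows "opt_cost {..<3 ^ K} (\<lambda>x y. f * ternary_dist x y) f us
    \<le> f * (2 ^ j * real (card ((\<lambda>x. x div 3 ^ j) ` set us)))"
  using opt_cost_le[OF f feasible_block_roots[OF f us, of j]]
  by (simp add: clustering_cost_def o_def sum_list_triv algebra_simps)

section \<open>Construction of the demand sequence\<close>

text \<open>The first bound keeps a cluster of radius \<open>r\<close> within one block of level
  \<open>l\<close>; the second, from minimality of \<open>l\<close>, bounds the loss of rounding up
  to that block.\<close>

lemma level_exists: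
  fixes f r :: real
  assumes "0 < f" "0 \<le> r"
  obtains l :: nat where "2 * r < 2 ^ l * f" "2 ^ l * f \<le> 4 * (f + r)"
proof -
  define l where "l = (LEAST l::nat. 2 * r < 2 ^ l * f)"
  obtain k where "2 * r / f < 2 ^ k" using real_arch_pow[of 2 "2 * r / f"] by auto
  then have "2 * r < 2 ^ k * f" using assms by (simp add: field_simps)
  then have l: "2 * r < 2 ^ l * f" unfolding l_def by (rule LeastI)
  have "2 ^ l * f \<le> 4 * (f + r)"
  proof (cases l)
    case 0
    then show ?thesis using assms by simp
  next
    case (Suc m)
    then have "\<not> 2 * r < 2 ^ m * f" unfolding l_def by (intro not_less_Least) simp
    then show ?thesis using Suc assms by simp
  qed
  with l that show thesis by blast
qed

text \<open>Induction along the scan of the nodes: \<open>x\<close> is demanded iff it lies in no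
  block bought so far. Each demand opens one cluster, so the two lists run in parallel. The last two
  properties are the hypotheses of \<open>sum_card_blocks_le\<close>.\<close>

lemma adversary:
  fixes f :: real and K :: nat
  defines "V \<equiv> {..<3 ^ K} :: nat set" and "d \<equiv> \<lambda>x y. f * ternary_dist x y"
  assumes f: "0 < f" and A: "online_algorithm V d A" and x: "x \<le> 3 ^ K"
  obtains us and l :: "nat \<Rightarrow> nat" where "distinct us" "set us \<subseteq> {..<x}"
    "list_all2 (\<lambda>u (p, r). d p u \<le> r \<and> 2 * r < 2 ^ l u * f \<and> 2 ^ l u * f \<le> 4 * (f + r)) us (opened V d A us)"
    "\<And>u v. u \<in> set us \<Longrightarrow> v \<in> set us \<Longrightarrow> u < v \<Longrightarrow> v div 3 ^ l u \<noteq> u div 3 ^ l u"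
    "\<And>y. y < x \<Longrightarrow> \<exists>u\<in>set us. u \<le> y \<and> y div 3 ^ l u = u div 3 ^ l u"
proof -
  interpret d: parent_metric parent "\<lambda>x. f * 2 ^ multiplicity 3 x" d
    unfolding d_def by (rule parent_metric_scaled_ternary_dist[OF f])
  let ?R = "\<lambda>(l :: nat \<Rightarrow> nat) u (p, r). d p u \<le> r \<and> 2 * r < 2 ^ l u * f \<and> 2 ^ l u * f \<le> 4 * (f + r)"
  have "\<exists>us l. distinct us \<and> set us \<subseteq> {..<x} \<and> list_all2 (?R l) us (opened V d A us) \<and>
     (\<forall>u\<in>set us. \<forall>v\<in>set us. u < v \<longrightarrow> v div 3 ^ l u \<noteq> u div 3 ^ l u) \<and>
     (\<forall>y<x. \<exists>u\<in>set us. u \<le> y \<and> y div 3 ^ l u = u div 3 ^ l u)"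
    using x
  proof (induction x)
    case 0
    then show ?case by (intro exI[of _ "[]"]) auto
  next
    case (Suc x)
    then obtain us l where us: "distinct us" "set us \<subseteq> {..<x}"
      and R: "list_all2 (?R l) us (opened V d A us)"
      and sep: "\<forall>u\<in>set us. \<forall>v\<in>set us. u < v \<longrightarrow> v div 3 ^ l u \<noteq> u div 3 ^ l u"
      and cov: "\<forall>y<x. \<exists>u\<in>set us. u \<le> y \<and> y div 3 ^ l u = u div 3 ^ l u"
      by auto
    show ?case
    proof (cases "\<exists>u\<in>set us. x div 3 ^ l u = u div 3 ^ l u")
      case True
      then have "\<forall>y<Suc x. \<exists>u\<in>set us. u \<le> y \<and> y div 3 ^ l u = u div 3 ^ l u"
        using cov us(2) by (metis less_SucE lessThan_iff less_imp_le subsetD)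
      moreover have "set us \<subseteq> {..<Suc x}" using us(2) by auto
      ultimately show ?thesis using us(1) R sep by blast
    next
      case False
      have xV: "x \<in> V" "set us \<subseteq> V" using Suc.prems us(2) by (auto simp: V_def)
      have unc: "x \<notin> covered V d (opened V d A us)"
      proof
        assume "x \<in> covered V d (opened V d A us)"
        then obtain p r where pr: "(p, r) \<in> set (opened V d A us)" "d p x \<le> r"
          by (auto simp: covered_def cluster_def)
        then obtain u where u: "u \<in> set us" "d p u \<le> r" "2 * r < 2 ^ l u * f"
          using R by (fastforce simp: list_all2_conv_all_nth in_set_conv_nth)
        \<comment> \<open>\<open>x\<close> and \<open>u\<close> lie in different blocks of level
          \<open>l u\<close>, but a common cluster would put them within
          \<open>2 * r\<close>.\<close>
        then have "2 ^ l u \<le> ternary_dist x u" using False by (intro ternary_dist_ge) auto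
        then have "2 ^ l u * f \<le> d x u" using f by (simp add: d_def)
        also have "\<dots> \<le> 2 * r" using d.triangle[of x u p] d.sym[of x p] pr(2) u(2) by simp
        finally show False using u(3) by simp
      qed
      obtain p r where pr: "A (us @ [x]) = (p, r)" by fastforce
      then have px: "d p x \<le> r"
        using A[unfolded online_algorithm_def, rule_format, OF xV(2,1) unc] by (simp add: cluster_def)
      then have "0 \<le> r" using d.nonneg order_trans by blast
      then obtain m where m: "2 * r < 2 ^ m * f" "2 ^ m * f \<le> 4 * (f + r)"
        using level_exists[OF f] by blast
      define l' where "l' = l(x := m)"
      have xus: "x \<notin> set us" using us(2) by auto
      then have l': "l' u = l u" if "u \<in> set us" for u using that by (auto simp: l'_def)
      have "list_all2 (?R l') us (opened V d A us)"
        using R l' by (auto simp: list_all2_conv_all_nth)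
      then have "list_all2 (?R l') (us @ [x]) (opened V d A (us @ [x]))"
        using unc pr px m by (simp add: opened_snoc l'_def list_all2_appendI)
      moreover have "\<forall>u\<in>set (us @ [x]). \<forall>v\<in>set (us @ [x]). u < v \<longrightarrow> v div 3 ^ l' u \<noteq> u div 3 ^ l' u"
        using sep l' False us(2) by auto
      moreover have "\<exists>u\<in>set (us @ [x]). u \<le> y \<and> y div 3 ^ l' u = u div 3 ^ l' u" if "y < Suc x" for y
        using cov l' that by (cases "y = x") (auto simp: less_Suc_eq)
      moreover have "distinct (us @ [x])" "set (us @ [x]) \<subseteq> {..<Suc x}" using us xus by auto
      ultimately show ?thesis by blast
    qed
  qed
  then show thesis using that by blast
qed

section \<open>Comparison of the online and offline costs\<close>

text \<open>Each of the \<open>K + 1\<close> block solutions costs at least the optimum. Of the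
  factor 16, one 4 comes from the charging and one from rounding clusters to blocks.\<close>

lemma competitive_lower_bound:
  fixes f :: real and K :: nat
  defines "V \<equiv> {..<3 ^ K} :: nat set" and "d \<equiv> \<lambda>x y. f * ternary_dist x y"
  assumes f: "0 < f" and A: "online_algorithm V d A" and n: "3 ^ K \<le> n"
    and c: "competitive V d f A n c"
  shows "real (Suc K) \<le> 16 * c"
proof -
  obtain us and l :: "nat \<Rightarrow> nat" where us: "distinct us" "set us \<subseteq> {..<3 ^ K}"
    and R: "list_all2 (\<lambda>u (p, r). d p u \<le> r \<and> 2 * r < 2 ^ l u * f \<and> 2 ^ l u * f \<le> 4 * (f + r)) us (opened V d A us)"
    and sep: "\<And>u v. u \<in> set us \<Longrightarrow> v \<in> set us \<Longrightarrow> u < v \<Longrightarrow> v div 3 ^ l u \<noteq> u div 3 ^ l u"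
    and cov: "\<And>y. y < 3 ^ K \<Longrightarrow> \<exists>u\<in>set us. u \<le> y \<and> y div 3 ^ l u = u div 3 ^ l u"
    using adversary[OF f A[unfolded V_def d_def] order_refl] unfolding V_def d_def by blast
  \<comment> \<open>The ratio concerns sequences of length exactly \<open>n\<close>. Node
    \<open>0\<close> is always demanded, so repeating it changes neither cost.\<close>
  define vs where "vs = us @ replicate (n - length us) 0"
  have "length us = card (set us)" using us(1) by (simp add: distinct_card)
  also have "\<dots> \<le> 3 ^ K" using card_mono[OF _ us(2)] by simp
  finally have len: "length vs = n" using n by (simp add: vs_def)
  have zero: "0 \<in> set us" using cov[of 0] by auto
  then have vs: "set vs = set us" by (auto simp: vs_def)
  have "0 \<in> covered V d (opened V d A us)"
    using R zero by (fastforce simp: list_all2_conv_all_nth in_set_conv_nth covered_def cluster_def V_def)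
  then have op: "opened V d A vs = opened V d A us"
    unfolding vs_def by (intro opened_append_covered) auto
  have "f * (\<Sum>u\<leftarrow>us. 2 ^ l u) \<le> 4 * clustering_cost f (opened V d A us)"
    using R by (induction rule: list_all2_induct) (auto simp: clustering_cost_def algebra_simps)
  then have alg: "f * (\<Sum>u\<in>set us. 2 ^ l u) \<le> 4 * clustering_cost f (opened V d A vs)"
    using us(1) by (simp add: op sum_list_distinct_conv_sum_set)
  define opt where "opt = opt_cost V d f vs"
  have vsV: "set vs \<subseteq> {..<3 ^ K}" using vs us(2) by simp
  have "f \<le> opt" unfolding opt_def V_def d_def
    using zero vs by (intro opt_cost_ge[OF f _ feasible_block_roots[OF f vsV]]) auto
  then have opt: "0 < opt" using f by simp
  have "real (Suc K) * opt = (\<Sum>j\<le>K. opt)" by simp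
  also have "\<dots> \<le> (\<Sum>j\<le>K. f * (2 ^ j * real (card ((\<lambda>x. x div 3 ^ j) ` set us))))"
    using opt_cost_le_card_blocks[OF f vsV] by (intro sum_mono) (simp add: opt_def V_def d_def vs)
  also have "\<dots> = f * (\<Sum>j\<le>K. 2 ^ j * real (card ((\<lambda>x. x div 3 ^ j) ` set us)))"
    by (simp add: sum_distrib_left)
  also have "\<dots> \<le> f * (4 * (\<Sum>u\<in>set us. 2 ^ l u))"
    using f sum_card_blocks_le[of "set us" l K] us(2) sep cov by simp
  also have "\<dots> \<le> 16 * clustering_cost f (opened V d A vs)" using alg by simp
  also have "\<dots> \<le> 16 * (c * opt)"
    using c len vsV by (auto simp: competitive_def opt_def V_def)
  finally show ?thesis using opt by (simp add: mult.assoc[symmetric])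
qed

theorem theorem4:
  shows "\<exists>c>0. \<forall>\<^sub>F n in sequentially. \<forall>f>0.
           \<exists>(V :: nat set) d. Metric_space V d \<and> tree_metric V d \<and>
             (\<forall>A. online_algorithm V d A \<longrightarrow>
                ereal (c * ln (real n)) \<le> competitive_ratio V d f A n)"
proof (intro exI[of _ "1 / 32"] conjI eventually_sequentiallyI[of 1] allI impI)
  fix n :: nat and f :: real
  assume n: "1 \<le> n" and f: "0 < f"
  \<comment> \<open>Maximality of \<open>K\<close> gives
    \<open>ln n \<le> (K + 1) * ln 3 \<le> 2 * (K + 1)\<close>; with the factor 16 this yields the
    constant \<open>1 / 32\<close>.\<close>
  obtain K where K: "3 ^ K \<le> n" "n < 3 ^ Suc K"
    using ex_power_ivl1[of 3 n] n by auto
  let ?V = "{..<3 ^ K} :: nat set" and ?d = "\<lambda>x y. f * ternary_dist x y"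
  interpret d: parent_metric parent "\<lambda>x. f * 2 ^ multiplicity 3 x" ?d
    by (rule parent_metric_scaled_ternary_dist[OF f])
  have "real n \<le> real (3 ^ Suc K)" using K(2) by (simp only: of_nat_le_iff)
  then have "ln (real n) \<le> ln (3 ^ Suc K)" using n by (subst ln_le_cancel_iff) auto
  also have "\<dots> = real (Suc K) * ln 3" by (simp only: ln_realpow)
  also have "\<dots> \<le> real (Suc K) * 2" using ln_le_minus_one[of "3::real"] by (intro mult_left_mono) auto
  finally have ln: "1 / 32 * ln (real n) \<le> real (Suc K) / 16" by simp
  have "ereal (1 / 32 * ln (real n)) \<le> competitive_ratio ?V ?d f A n" if "online_algorithm ?V ?d A" for A
    unfolding competitive_ratio_def
  proof (rule INF_greatest)
    fix c assume "c \<in> {c. competitive ?V ?d f A n c}"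
    then have "real (Suc K) \<le> 16 * c" using competitive_lower_bound[OF f that K(1)] by simp
    then show "ereal (1 / 32 * ln (real n)) \<le> ereal c" using ln by simp
  qed
  moreover have "tree_metric ?V ?d"
    using d.tree_metric_atMost[of "3 ^ K - 1"] by (simp flip: lessThan_Suc_atMost)
  ultimately show "\<exists>(V :: nat set) d. Metric_space V d \<and> tree_metric V d \<and>
      (\<forall>A. online_algorithm V d A \<longrightarrow> ereal (1 / 32 * ln (real n)) \<le> competitive_ratio V d f A n)"
    using d.Metric_space by blast
qed simp

end
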